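(* Let $\|\cdot\|$ be a norm on $\mathbb{R}^n$ with dual norm $\|\cdot\|_\star$. Let $\Theta\subseteq\mathbb{R}^n$ be a non-empty closed convex set, $c^*\in\Theta$, $\lambda>0$, and let $\psi\colon\Theta\to\mathbb{R}$ be differentiable and $\lambda$-strongly convex with respect to $\|\cdot\|_\star$. Let $X_1,\dots,X_T\subseteq\mathbb{R}^n$ be non-empty compact (not necessarily convex) sets and $x_t\in X_t$ for $t=1,\dots,T$. Let $B,K,\Delta>0$ and assume: (a) $\max\left\{2^{5/2}\lambda\max_{c,c'\in\Theta}\|c-c'\|_\star^2,\ \max_{c,c'\in\Theta}\left(\psi(c)-\psi(c')\right)\right\}\le B^2$; (b) the diameter of every $X_t$ with respect to $\|\cdot\|$ is at most $K$; (c) the decision problems specified by $c^*$ and $X_1,\dots,X_T$ satisfy the $\Delta$-gap condition; (d) $x_t\in\arg\max_{x'\in X_t}\langle c^*,x'\rangle$ for every $t=1,\dots,T$. Let $\hat c_1,\dots,\hat c_T\in\Theta$, $\hat x_1,\dots,\hat x_T$, and $g_1,\dots,g_T$ be produced by the FTRL algorithm run on $(X_1,x_1),\dots,(X_T,x_T)$ with $\beta_t=\frac{2^{1/4}}{B}\sqrt{\frac{1}{\lambda}\sum_{i=1}^{t-1}\|g_i\|^2}$. Then $$R_T=\sum_{t=1}^T\langle g_t,\hat c_t-c^*\rangle\le\frac{2^{5/4}KB^3}{\lambda^{3/2}\Delta^2}.$$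
   Context: $\langle\cdot,\cdot\rangle$ is the standard inner product on $\mathbb{R}^n$. FTRL algorithm: for $t=1,\dots,T$, output $\hat c_t\in\arg\min_{c\in\Theta}\ \beta_t\psi(c)+\sum_{i=1}^{t-1}\langle g_i,c\rangle$, where $\hat c_1\in\Theta$ is arbitrary and $\hat c_t=\hat c_{t-1}$ if $g_{t-1}=0$; then observe $(X_t,x_t)$; compute any $\hat x_t\in\arg\max_{x'\in X_t}\langle\hat c_t,x'\rangle$; set $g_t=\hat x_t-x_t$. The linearized regret is $R_T=\sum_{t=1}^T\langle g_t,\hat c_t-c^*\rangle=\sum_{t=1}^T\left(\ell^{\mathrm{sub}}_t(\hat c_t)+\ell^{\mathrm{est}}_t(\hat c_t)\right)$, where $\ell^{\mathrm{sub}}_t(\hat c_t)=\langle\hat c_t,\hat x_t-x_t\rangle$ (suboptimality loss) and $\ell^{\mathrm{est}}_t(\hat c_t)=\langle c^*,x_t-\hat x_t\rangle$ (estimate loss). $\Delta$-gap condition ($\Delta>0$): for every $t=1,\dots,T$, for $x=\arg\max_{x'\in X_t}\langle c^*,x'\rangle$ it holds that $\langle c^*,x-\hat x\rangle\ge\Delta\|x-\hat x\|$ for all $\hat x\in X_t$ (which implies that the maximizer $x$ is unique). *)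

theory Defs
  imports "HOL-Analysis.Analysis"
begin

definition is_norm :: "('a::real_vector \<Rightarrow> real) \<Rightarrow> bool" where
  "is_norm N \<longleftrightarrow>
     (\<forall>x. N x \<ge> 0) \<and>
     (\<forall>x. N x = 0 \<longleftrightarrow> x = 0) \<and>
     (\<forall>a x. N (a *\<^sub>R x) = \<bar>a\<bar> * N x) \<and>
     (\<forall>x y. N (x + y) \<le> N x + N y)"

definition dual_norm :: "('a::real_inner \<Rightarrow> real) \<Rightarrow> 'a \<Rightarrow> real" where
  "dual_norm N y = (SUP x\<in>{x. N x \<le> 1}. y \<bullet> x)"

definition strongly_convex_on ::
    "real \<Rightarrow> ('a::real_vector \<Rightarrow> real) \<Rightarrow> 'a set \<Rightarrow> ('a \<Rightarrow> real) \<Rightarrow> bool" where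
  "strongly_convex_on lam N S f \<longleftrightarrow>
     (\<forall>x\<in>S. \<forall>y\<in>S. \<forall>u\<ge>0. \<forall>v\<ge>0. u + v = 1 \<longrightarrow>
        f (u *\<^sub>R x + v *\<^sub>R y) \<le> u * f x + v * f y - lam / 2 * u * v * (N (x - y))\<^sup>2)"

definition gap_condition ::
    "('a::real_inner \<Rightarrow> real) \<Rightarrow> real \<Rightarrow> nat \<Rightarrow> 'a \<Rightarrow> (nat \<Rightarrow> 'a set) \<Rightarrow> bool" where
  "gap_condition N \<Delta> T cstar X \<longleftrightarrow>
     (\<forall>t\<in>{1..T}. \<forall>x. is_arg_max (\<lambda>x'. cstar \<bullet> x') (\<lambda>x'. x' \<in> X t) x \<longrightarrow>
        (\<forall>xhat\<in>X t. cstar \<bullet> (x - xhat) \<ge> \<Delta> * N (x - xhat)))"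

text \<open>
  The rule for a vanishing previous subgradient takes precedence over the minimisation.
  If \<open>\<beta>\<close> and the linear part are unchanged by \<open>g (t - 1) = 0\<close>, as they are when \<open>\<beta> t\<close> is a
  function of the sum of squared norms of \<open>g 1, \<dots>, g (t - 1)\<close>, the point kept is still a
  minimiser in round \<open>t\<close> (for \<open>\<beta> t = 0\<close> and zero subgradients so far, every point of
  \<open>\<Theta>\<close> is).
\<close>
definition ftrl_run ::
    "'a::real_inner set \<Rightarrow> ('a \<Rightarrow> real) \<Rightarrow> (nat \<Rightarrow> real) \<Rightarrow> nat \<Rightarrow> (nat \<Rightarrow> 'a set) \<Rightarrow> (nat \<Rightarrow> 'a) \<Rightarrow>
     (nat \<Rightarrow> 'a) \<Rightarrow> (nat \<Rightarrow> 'a) \<Rightarrow> (nat \<Rightarrow> 'a) \<Rightarrow> bool" where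
  "ftrl_run \<Theta> \<psi> \<beta> T X x chat xhat g \<longleftrightarrow>
     (\<forall>t\<in>{1..T}.
        chat t \<in> \<Theta> \<and>
        (t \<ge> 2 \<longrightarrow>
          (if g (t - 1) = 0 then chat t = chat (t - 1)
           else is_arg_min (\<lambda>c. \<beta> t * \<psi> c + (\<Sum>i=1..<t. g i \<bullet> c)) (\<lambda>c. c \<in> \<Theta>) (chat t))) \<and>
        is_arg_max (\<lambda>x'. chat t \<bullet> x') (\<lambda>x'. x' \<in> X t) (xhat t) \<and>
        g t = xhat t - x t)"

end

theory Submission
  imports Defs
begin

text \<open>
  Two bounds on the regret \<open>R\<close> are played against each other. With
  \<open>k = B / (2\<^bsup>5/4\<^esup> \<surd>\<lambda>)\<close>, which bounds the dual diameter of \<open>\<Theta>\<close>, the usual analysis of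
  follow-the-regularized-leader gives \<open>R \<le> 4\<surd>2 k \<surd>(\<Sum> \<parallel>g\<^sub>t\<parallel>\<^sup>2)\<close>. Conversely,
  both losses in \<open>\<langle>g\<^sub>t, c\<^sub>t - c\<^sup>*\<rangle>\<close> are nonnegative, and the gap condition bounds the
  estimate loss below by \<open>\<Delta> \<parallel>g\<^sub>t\<parallel>\<close>; hence \<open>\<Sum> \<parallel>g\<^sub>t\<parallel>\<^sup>2 \<le> K \<Sum> \<parallel>g\<^sub>t\<parallel> \<le> K R / \<Delta>\<close>. Together
  \<open>R \<le> 32 k\<^sup>2 K / \<Delta>\<close>, and \<open>\<Delta> \<le> k\<close> unless every \<open>g\<^sub>t\<close> vanishes. The claimed bound is
  \<open>32 k\<^sup>3 K / \<Delta>\<^sup>2\<close>.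
\<close>

section \<open>Norms on Euclidean space and the duality inequality\<close>

lemma is_normD:
  assumes "is_norm N"
  shows "N x \<ge> 0" and "N 0 = 0" and "x \<noteq> 0 \<Longrightarrow> N x > 0"
    and "N (a *\<^sub>R x) = \<bar>a\<bar> * N x" and "N (x + y) \<le> N x + N y" and "N (- x) = N x"
proof -
  note N = assms[unfolded is_norm_def]
  show "N x \<ge> 0" "N 0 = 0" "N (x + y) \<le> N x + N y"
    using N by blast+
  show "N x > 0" if "x \<noteq> 0"
    using N that by (metis less_eq_real_def)
  show scale: "N (a *\<^sub>R x) = \<bar>a\<bar> * N x" for a
    using N by blast
  show "N (- x) = N x"
    using scale[of "-1"] by simp
qed

lemma is_norm_convex_on:
  assumes "is_norm N"
  shows "convex_on UNIV N"
proof (rule convex_onI)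
  fix t :: real and x y
  assume t: "0 < t" "t < 1"
  have "N ((1 - t) *\<^sub>R x + t *\<^sub>R y) \<le> N ((1 - t) *\<^sub>R x) + N (t *\<^sub>R y)"
    by (rule is_normD(5)[OF assms])
  also have "\<dots> = (1 - t) * N x + t * N y"
    using t by (simp add: is_normD(4)[OF assms])
  finally show "N ((1 - t) *\<^sub>R x + t *\<^sub>R y) \<le> (1 - t) * N x + t * N y" .
qed simp

text \<open>Convexity makes \<open>N\<close> continuous, so it has a minimum on the compact
  Euclidean unit sphere, which is positive; homogeneity does the rest.\<close>

lemma is_norm_ge_norm:
  fixes N :: "'a::euclidean_space \<Rightarrow> real"
  assumes N: "is_norm N"
  obtains e where "e > 0" "\<And>x. e * norm x \<le> N x"
proof -
  have "continuous_on UNIV N"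
    by (rule convex_on_continuous[OF open_UNIV is_norm_convex_on[OF N]])
  then have cont: "continuous_on (sphere 0 1) N"
    by (rule continuous_on_subset) simp
  obtain b :: 'a where "b \<in> Basis"
    using nonempty_Basis by blast
  then have "sphere (0::'a) 1 \<noteq> {}"
    by (auto simp: dist_norm intro!: exI[of _ b])
  then obtain z where z: "z \<in> sphere 0 1" and min: "\<And>y. y \<in> sphere 0 1 \<Longrightarrow> N z \<le> N y"
    using continuous_attains_inf[OF compact_sphere _ cont] by blast
  show ?thesis
  proof (rule that)
    have "z \<noteq> 0"
      using z by auto
    then show "N z > 0"
      by (rule is_normD(3)[OF N])
    fix x
    show "N z * norm x \<le> N x"
    proof (cases "x = 0")
      case True
      then show ?thesis
        by (simp add: is_normD(2)[OF N])
    next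
      case False
      have "N z \<le> N ((1 / norm x) *\<^sub>R x)"
        using False by (intro min) simp
      also have "\<dots> = N x / norm x"
        by (simp add: is_normD(4)[OF N])
      finally show ?thesis
        using False by (simp add: field_simps)
    qed
  qed
qed

text \<open>Boundedness is what makes the \<open>SUP\<close> in \<open>dual_norm\<close> a genuine
  upper bound. It comes from comparing \<open>N\<close> with the Euclidean norm and from
  Cauchy-Schwarz.\<close>

lemma bdd_above_dual_norm:
  fixes N :: "'a::euclidean_space \<Rightarrow> real"
  assumes "is_norm N"
  shows "bdd_above ((\<lambda>x. y \<bullet> x) ` {x. N x \<le> 1})"
proof -
  obtain e where e: "e > 0" "\<And>x. e * norm x \<le> N x"
    using is_norm_ge_norm[OF assms] by blast
  show ?thesis
  proof (rule bdd_aboveI2)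
    fix x assume "x \<in> {x. N x \<le> 1}"
    then have "e * norm x \<le> 1"
      using e(2)[of x] by simp
    then have "norm x \<le> 1 / e"
      using e(1) by (simp add: field_simps)
    then have "norm y * norm x \<le> norm y * (1 / e)"
      by (rule mult_left_mono) simp
    then show "y \<bullet> x \<le> norm y * (1 / e)"
      using norm_cauchy_schwarz[of y x] by linarith
  qed
qed

lemma dual_norm_nonneg:
  fixes N :: "'a::euclidean_space \<Rightarrow> real"
  assumes "is_norm N"
  shows "0 \<le> dual_norm N y"
proof -
  have "y \<bullet> 0 \<le> dual_norm N y"
    unfolding dual_norm_def by (intro cSUP_upper bdd_above_dual_norm[OF assms])
      (simp add: is_normD(2)[OF assms])
  then show ?thesis
    by simp
qed

lemma inner_le_norm_dual_norm:
  fixes N :: "'a::euclidean_space \<Rightarrow> real"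
  assumes N: "is_norm N"
  shows "x \<bullet> y \<le> N x * dual_norm N y"
proof (cases "x = 0")
  case True
  then show ?thesis
    by (simp add: is_normD(2)[OF N])
next
  case False
  then have pos: "N x > 0"
    by (rule is_normD(3)[OF N])
  have "N ((1 / N x) *\<^sub>R x) \<le> 1"
    using pos by (simp add: is_normD(4)[OF N])
  then have "y \<bullet> ((1 / N x) *\<^sub>R x) \<le> dual_norm N y"
    unfolding dual_norm_def by (intro cSUP_upper bdd_above_dual_norm[OF N]) simp
  then show ?thesis
    using pos by (simp add: field_simps inner_commute)
qed

section \<open>Follow-the-regularized-leader\<close>

text \<open>Compare \<open>p\<close> with a point of the segment towards \<open>c\<close>. After
  division by \<open>1 - z\<close> the strong convexity term survives with factor \<open>z\<close>,
  and \<open>z\<close> may tend to 1.\<close>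

lemma strongly_convex_on_minimizer_growth:
  fixes f :: "'a::real_inner \<Rightarrow> real"
  assumes sc: "strongly_convex_on lam M S f" and "convex S" and "b \<ge> 0"
    and min: "is_arg_min (\<lambda>c. b * f c + h \<bullet> c) (\<lambda>c. c \<in> S) p"
    and c: "c \<in> S"
  shows "b * f p + h \<bullet> p + b * lam / 2 * (M (p - c))\<^sup>2 \<le> b * f c + h \<bullet> c"
proof -
  have p: "p \<in> S" and le: "\<And>q. q \<in> S \<Longrightarrow> b * f p + h \<bullet> p \<le> b * f q + h \<bullet> q"
    using min by (auto simp: is_arg_min_linorder)
  have "b * lam / 2 * (M (p - c))\<^sup>2 \<le> (b * f c + h \<bullet> c) - (b * f p + h \<bullet> p)"
  proof (rule field_le_mult_one_interval)
    fix z :: real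
    assume z: "0 < z" "z < 1"
    define q where "q = z *\<^sub>R p + (1 - z) *\<^sub>R c"
    have q: "q \<in> S"
      unfolding q_def using \<open>convex S\<close> p c z by (intro convexD) auto
    have "f q \<le> z * f p + (1 - z) * f c - lam / 2 * z * (1 - z) * (M (p - c))\<^sup>2"
      unfolding q_def using sc p c z by (auto simp: strongly_convex_on_def)
    then have "b * f q \<le> b * (z * f p + (1 - z) * f c - lam / 2 * z * (1 - z) * (M (p - c))\<^sup>2)"
      using \<open>b \<ge> 0\<close> by (rule mult_left_mono)
    moreover have "h \<bullet> q = z * (h \<bullet> p) + (1 - z) * (h \<bullet> c)"
      by (simp add: q_def inner_add_right)
    ultimately have "(1 - z) * (z * (b * lam / 2 * (M (p - c))\<^sup>2))
        \<le> (1 - z) * ((b * f c + h \<bullet> c) - (b * f p + h \<bullet> p))"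
      using le[OF q] by (simp add: algebra_simps)
    then show "z * (b * lam / 2 * (M (p - c))\<^sup>2) \<le> (b * f c + h \<bullet> c) - (b * f p + h \<bullet> p)"
      using z by simp
  qed
  then show ?thesis
    by simp
qed

text \<open>Absorbs the two exceptional rules of the run. In round 1 all sums are empty and the
  objective vanishes, so any point minimises it; after a zero subgradient the objective is
  unchanged, so the point kept still minimises it.\<close>

lemma ftrl_run_is_arg_min:
  assumes run: "ftrl_run \<Theta> \<psi> \<beta> T X x chat xhat g"
    and N: "is_norm N"
    and beta: "\<And>t. t \<in> {1..T} \<Longrightarrow> \<beta> t = \<alpha> * sqrt (\<Sum>i=1..<t. (N (g i))\<^sup>2)"
    and t: "t \<in> {1..T}"
  shows "is_arg_min (\<lambda>c. \<beta> t * \<psi> c + (\<Sum>i=1..<t. g i \<bullet> c)) (\<lambda>c. c \<in> \<Theta>) (chat t)"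
proof -
  have "1 \<le> t" "t \<le> T"
    using t by auto
  then show ?thesis
  proof (induction t rule: dec_induct)
    case base
    then show ?case
      using run beta[of 1] by (auto simp: ftrl_run_def is_arg_min_linorder)
  next
    case (step t)
    have S: "Suc t \<in> {1..T}" "t \<in> {1..T}"
      using step.hyps step.prems by auto
    have round: "if g t = 0 then chat (Suc t) = chat t
        else is_arg_min (\<lambda>c. \<beta> (Suc t) * \<psi> c + (\<Sum>i=1..<Suc t. g i \<bullet> c)) (\<lambda>c. c \<in> \<Theta>) (chat (Suc t))"
      using bspec[OF run[unfolded ftrl_run_def] S(1)] step.hyps(1)
      by (auto split: if_splits)
    show ?case
    proof (cases "g t = 0")
      case True
      then have g: "N (g t) = 0"
        by (simp add: is_normD(2)[OF N])
      have "chat (Suc t) = chat t"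
        using round True by simp
      moreover have "\<beta> (Suc t) = \<beta> t"
        using step.hyps g by (simp add: beta[OF S(1)] beta[OF S(2)])
      moreover have "(\<Sum>i=1..<Suc t. g i \<bullet> c) = (\<Sum>i=1..<t. g i \<bullet> c)" for c
        using step.hyps True by simp
      ultimately show ?thesis
        using step.IH S by simp
    next
      case False
      then show ?thesis
        using round by simp
    qed
  qed
qed

text \<open>\<open>a * y\<close> bounds the cost of a new subgradient of norm \<open>a\<close> at
  distance \<open>y\<close>, the quadratic term is the gain from strong convexity, and the right
  side telescopes over the rounds. If \<open>a\<close> is small compared with \<open>s\<close>,
  maximising over \<open>y\<close> suffices; otherwise \<open>y \<le> k\<close> does.\<close>

lemma ftrl_step_ineq:
  fixes a s y k :: real
  assumes "a \<ge> 0" "s \<ge> 0" "0 \<le> y" "y \<le> k" "k > 0"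
  shows "a * y - s * y\<^sup>2 / (4 * k) \<le> 5 / 2 * k * (sqrt (s\<^sup>2 + a\<^sup>2) - s)"
proof -
  define r where "r = sqrt (s\<^sup>2 + a\<^sup>2)"
  have r2: "r\<^sup>2 = s\<^sup>2 + a\<^sup>2"
    by (simp add: r_def)
  have rs: "s \<le> r"
    unfolding r_def by (rule real_le_rsqrt) simp
  have a2: "a\<^sup>2 = (r - s) * (r + s)"
    using r2 by (simp add: power2_eq_square algebra_simps)
  define z where "z = y / k"
  have y: "y = k * z" and z: "0 \<le> z" "z \<le> 1"
    using assms by (auto simp: z_def)
  have "a * z - s * z\<^sup>2 / 4 \<le> 5 / 2 * (r - s)"
  \<comment> \<open>In the first case the factor \<open>r + s\<close> of \<open>a\<^sup>2\<close> is
    at most \<open>5 / 2 * s\<close>. In the second it is at most \<open>5 * (r - s)\<close>, and 5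
    is relaxed to 25/4 so that the root again has constant 5/2.\<close>
  proof (cases "2 * r \<le> 3 * s")
    case True
    show ?thesis
    proof (cases "s = 0")
      case True
      with \<open>2 * r \<le> 3 * s\<close> rs have "r = 0" by simp
      then show ?thesis using a2 True by simp
    next
      case False
      then have s: "s > 0" using \<open>s \<ge> 0\<close> by simp
      \<comment> \<open>Completing the square bounds the quadratic in \<open>z\<close> by
        \<open>a\<^sup>2 / s\<close>.\<close>
      have "0 \<le> (a - s * z / 2)\<^sup>2"
        by simp
      then have "s * (a * z - s * z\<^sup>2 / 4) \<le> a\<^sup>2"
        by (simp add: power2_eq_square field_simps)
      also have "\<dots> \<le> (r - s) * (5 / 2 * s)"
        unfolding a2 using rs True by (intro mult_left_mono) auto
      also have "\<dots> = s * (5 / 2 * (r - s))"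
        by simp
      finally show ?thesis
        using s by simp
    qed
  next
    case False
    have "a\<^sup>2 \<le> (r - s) * (25 / 4 * (r - s))"
      unfolding a2 using rs False \<open>s \<ge> 0\<close> by (intro mult_left_mono) auto
    also have "\<dots> = (5 / 2 * (r - s))\<^sup>2"
      by (simp add: power2_eq_square algebra_simps)
    finally have "a \<le> 5 / 2 * (r - s)"
      by (rule power2_le_imp_le) (use rs in simp)
    moreover have "a * z \<le> a"
      using z \<open>a \<ge> 0\<close> by (simp add: mult_left_le)
    moreover have "0 \<le> s * z\<^sup>2 / 4"
      using \<open>s \<ge> 0\<close> by simp
    ultimately show ?thesis
      by linarith
  qed
  then have "k * (a * z - s * z\<^sup>2 / 4) \<le> k * (5 / 2 * (r - s))"
    using \<open>k > 0\<close> by (intro mult_left_mono) auto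
  then show ?thesis
    using \<open>k > 0\<close> unfolding y r_def by (simp add: power2_eq_square algebra_simps)
qed

text \<open>
  As \<open>\<beta> t\<close> does not involve \<open>g t\<close>, it may be too small compared with \<open>g t\<close> for strong convexity to
  control round \<open>t\<close>; the diameter bound \<open>k\<close> of \<open>\<Theta>\<close> covers these rounds.
\<close>
lemma ftrl_regret_bound:
  fixes N :: "'a::euclidean_space \<Rightarrow> real"
  assumes run: "ftrl_run \<Theta> \<psi> \<beta> T X x chat xhat g"
    and N: "is_norm N"
    and beta: "\<And>t. t \<in> {1..T} \<Longrightarrow> \<beta> t = \<alpha> * sqrt (\<Sum>i=1..<t. (N (g i))\<^sup>2)"
    and sc: "strongly_convex_on lam (dual_norm N) \<Theta> \<psi>"
    and "convex \<Theta>"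
    and "\<alpha> \<ge> 0" and k: "k > 0" "2 * lam * \<alpha> * k = 1"
    and diam: "\<And>c c'. c \<in> \<Theta> \<Longrightarrow> c' \<in> \<Theta> \<Longrightarrow> dual_norm N (c - c') \<le> k"
    and m: "\<And>c. c \<in> \<Theta> \<Longrightarrow> m \<le> \<psi> c"
    and "t \<le> T" and "c \<in> \<Theta>"
  shows "(\<Sum>i=1..t. g i \<bullet> (chat i - c))
           \<le> (\<alpha> * (\<psi> c - m) + 5 / 2 * k) * sqrt (\<Sum>i=1..t. (N (g i))\<^sup>2)"
  using \<open>t \<le> T\<close> \<open>c \<in> \<Theta>\<close>
\<comment> \<open>The comparator varies: earlier rounds are compared with the next iterate
  \<open>p\<close>, and the optimality of \<open>p\<close> for the past subgradients then leads from
  \<open>p\<close> to \<open>c\<close>.\<close>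
proof (induction t arbitrary: c)
  case 0
  then show ?case
    by simp
next
  case (Suc t)
  define s where "s = sqrt (\<Sum>i=1..t. (N (g i))\<^sup>2)"
  define a where "a = N (g (Suc t))"
  define p where "p = chat (Suc t)"
  define y where "y = dual_norm N (p - c)"
  have T: "Suc t \<in> {1..T}"
    using Suc.prems by simp
  have s: "s \<ge> 0" "s\<^sup>2 = (\<Sum>i=1..t. (N (g i))\<^sup>2)"
    by (auto simp: s_def sum_nonneg)
  have a: "a \<ge> 0"
    by (simp add: a_def is_normD(1)[OF N])
  have b: "\<beta> (Suc t) = \<alpha> * s"
    using beta[OF T] by (simp add: s_def atLeastLessThanSuc_atLeastAtMost)
  have min: "is_arg_min (\<lambda>c. \<alpha> * s * \<psi> c + (\<Sum>i=1..t. g i) \<bullet> c) (\<lambda>c. c \<in> \<Theta>) p"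
    using ftrl_run_is_arg_min[OF run N beta T]
    by (simp add: b p_def atLeastLessThanSuc_atLeastAtMost inner_sum_left)
  then have p: "p \<in> \<Theta>"
    by (simp add: is_arg_min_def)
  have growth: "(\<Sum>i=1..t. g i) \<bullet> (p - c) \<le> \<alpha> * s * (\<psi> c - \<psi> p) - \<alpha> * s * lam / 2 * y\<^sup>2"
    using strongly_convex_on_minimizer_growth[OF sc \<open>convex \<Theta>\<close> _ min Suc.prems(2)] s \<open>\<alpha> \<ge> 0\<close>
    by (simp add: y_def inner_diff_right algebra_simps)
  have IH: "(\<Sum>i=1..t. g i \<bullet> (chat i - p)) \<le> (\<alpha> * (\<psi> p - m) + 5 / 2 * k) * s"
    using Suc.IH[OF _ p] Suc.prems by (simp add: s_def)
  have "(\<Sum>i=1..Suc t. g i \<bullet> (chat i - c))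
      = (\<Sum>i=1..t. g i \<bullet> (chat i - p) + g i \<bullet> (p - c)) + g (Suc t) \<bullet> (p - c)"
    by (simp add: p_def inner_diff_right)
  also have "\<dots> = (\<Sum>i=1..t. g i \<bullet> (chat i - p)) + (\<Sum>i=1..t. g i) \<bullet> (p - c)
      + g (Suc t) \<bullet> (p - c)"
    by (simp only: sum.distrib inner_sum_left)
  \<comment> \<open>The terms in \<open>\<psi> p\<close> from the induction hypothesis and from
    \<open>growth\<close> cancel in the next step.\<close>
  also have "\<dots> \<le> (\<alpha> * (\<psi> p - m) + 5 / 2 * k) * s
      + (\<alpha> * s * (\<psi> c - \<psi> p) - \<alpha> * s * lam / 2 * y\<^sup>2) + a * y"
    unfolding a_def y_def
    by (intro add_mono inner_le_norm_dual_norm[OF N] IH growth[unfolded y_def])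
  also have "\<dots> = \<alpha> * (\<psi> c - m) * s + 5 / 2 * k * s + (a * y - s * y\<^sup>2 * (\<alpha> * lam / 2))"
    by (simp add: algebra_simps)
  \<comment> \<open>The normalisation \<open>2 * lam * \<alpha> * k = 1\<close> brings the curvature
    term into the form of \<open>ftrl_step_ineq\<close>.\<close>
  also have "\<alpha> * lam / 2 = 1 / (4 * k)"
    using k by (simp add: field_simps)
  also have "\<alpha> * (\<psi> c - m) * s + 5 / 2 * k * s + (a * y - s * y\<^sup>2 * (1 / (4 * k)))
      \<le> \<alpha> * (\<psi> c - m) * sqrt (s\<^sup>2 + a\<^sup>2) + 5 / 2 * k * s + 5 / 2 * k * (sqrt (s\<^sup>2 + a\<^sup>2) - s)"
  proof -
    have "\<alpha> * (\<psi> c - m) * s \<le> \<alpha> * (\<psi> c - m) * sqrt (s\<^sup>2 + a\<^sup>2)"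
      using m[OF Suc.prems(2)] \<open>\<alpha> \<ge> 0\<close> by (intro mult_left_mono real_le_rsqrt) auto
    moreover have "a * y - s * y\<^sup>2 / (4 * k) \<le> 5 / 2 * k * (sqrt (s\<^sup>2 + a\<^sup>2) - s)"
      using a s k diam[OF p Suc.prems(2)] dual_norm_nonneg[OF N]
      by (intro ftrl_step_ineq) (auto simp: y_def)
    ultimately show ?thesis
      by simp
  qed
  also have "\<dots> = (\<alpha> * (\<psi> c - m) + 5 / 2 * k) * sqrt (s\<^sup>2 + a\<^sup>2)"
    by (simp add: algebra_simps)
  also have "s\<^sup>2 + a\<^sup>2 = (\<Sum>i=1..Suc t. (N (g i))\<^sup>2)"
    by (simp add: s(2) a_def)
  finally show ?case .
qed

section \<open>Combining the regret bound with the gap condition\<close>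

theorem theorem5p2:
  fixes N :: "real ^ 'n \<Rightarrow> real"
    and \<Theta> :: "(real ^ 'n) set"
    and cstar :: "real ^ 'n"
    and \<psi> :: "real ^ 'n \<Rightarrow> real"
    and lam B K \<Delta> :: real
    and T :: nat
    and X :: "nat \<Rightarrow> (real ^ 'n) set"
    and x chat xhat g :: "nat \<Rightarrow> real ^ 'n"
    and \<beta> :: "nat \<Rightarrow> real"
  assumes norm: "is_norm N"
    and Theta: "\<Theta> \<noteq> {}" "closed \<Theta>" "convex \<Theta>"
    and cstar: "cstar \<in> \<Theta>"
    and lam: "lam > 0"
    and psi_diff: "\<psi> differentiable_on \<Theta>"
    and psi_sc: "strongly_convex_on lam (dual_norm N) \<Theta> \<psi>"
    and X: "\<And>t. t \<in> {1..T} \<Longrightarrow> X t \<noteq> {} \<and> compact (X t)"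
    and x: "\<And>t. t \<in> {1..T} \<Longrightarrow> x t \<in> X t"
    and pos: "B > 0" "K > 0" "\<Delta> > 0"
    and a1: "\<And>c c'. c \<in> \<Theta> \<Longrightarrow> c' \<in> \<Theta> \<Longrightarrow>
               2 powr (5 / 2) * lam * (dual_norm N (c - c'))\<^sup>2 \<le> B\<^sup>2"
    and a2: "\<And>c c'. c \<in> \<Theta> \<Longrightarrow> c' \<in> \<Theta> \<Longrightarrow> \<psi> c - \<psi> c' \<le> B\<^sup>2"
    and b: "\<And>t y z. t \<in> {1..T} \<Longrightarrow> y \<in> X t \<Longrightarrow> z \<in> X t \<Longrightarrow> N (y - z) \<le> K"
    and c: "gap_condition N \<Delta> T cstar X"
    and d: "\<And>t. t \<in> {1..T} \<Longrightarrow>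
              is_arg_max (\<lambda>x'. cstar \<bullet> x') (\<lambda>x'. x' \<in> X t) (x t)"
    and beta: "\<And>t. t \<in> {1..T} \<Longrightarrow>
                 \<beta> t = 2 powr (1 / 4) / B * sqrt (1 / lam * (\<Sum>i=1..<t. (N (g i))\<^sup>2))"
    and run: "ftrl_run \<Theta> \<psi> \<beta> T X x chat xhat g"
  shows "(\<Sum>t=1..T. g t \<bullet> (chat t - cstar))
           \<le> 2 powr (5 / 4) * K * B ^ 3 / (lam powr (3 / 2) * \<Delta>\<^sup>2)"
proof -
  \<comment> \<open>\<open>w\<close> and \<open>l\<close> turn the fractional powers of 2 and
    \<open>lam\<close> into integer powers. \<open>k\<close> is the dual diameter bound read off
    from \<open>a1\<close>, and \<open>\<alpha>\<close> is the factor of the root in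
    \<open>\<beta>\<close>.\<close>
  define w :: real where "w = 2 powr (1 / 4)"
  define l where "l = sqrt lam"
  define k where "k = B / (w ^ 5 * l)"
  define \<alpha> where "\<alpha> = w / (B * l)"
  define R where "R = (\<Sum>t=1..T. g t \<bullet> (chat t - cstar))"
  define A where "A = (\<Sum>t=1..T. N (g t))"
  define Q where "Q = (\<Sum>t=1..T. (N (g t))\<^sup>2)"
  have w: "w > 0" and w4: "w ^ 4 = 2"
    by (simp_all add: w_def powr_power)
  have l: "l > 0" and l2: "l\<^sup>2 = lam"
    using lam by (simp_all add: l_def)
  have powers: "2 powr (5 / 4) = w ^ 5" "2 powr (5 / 2) = w ^ 10"
    by (simp_all add: w_def powr_power)
  have l3: "lam powr (3 / 2) = l ^ 3"
    using lam by (simp add: l_def powr_half_sqrt[symmetric] powr_power)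
  have k: "k > 0" and B: "B = k * w ^ 5 * l"
    using pos w l by (simp_all add: k_def)
  have "\<alpha> \<ge> 0"
    using pos w l by (simp add: \<alpha>_def)
  have beta': "\<beta> t = \<alpha> * sqrt (\<Sum>i=1..<t. (N (g i))\<^sup>2)" if "t \<in> {1..T}" for t
    using beta[OF that] by (simp add: \<alpha>_def w_def l_def real_sqrt_mult real_sqrt_divide)
  have "2 * lam * \<alpha> * k = 2 * (l\<^sup>2 / l / l) * (w * B / B) / w ^ 5"
    unfolding l2[symmetric] \<alpha>_def k_def by (simp add: ac_simps)
  also have "\<dots> = 2 / w ^ 4"
    using pos w l by (simp add: power2_eq_square field_simps eval_nat_numeral)
  finally have \<alpha>k: "2 * lam * \<alpha> * k = 1"
    using w4 by simp
  have diam: "dual_norm N (p - q) \<le> k" if "p \<in> \<Theta>" "q \<in> \<Theta>" for p q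
  proof -
    have "(w ^ 5 * l * dual_norm N (p - q))\<^sup>2 \<le> B\<^sup>2"
      using a1[OF that] unfolding powers l2[symmetric] by (simp add: power_mult_distrib)
    then have "w ^ 5 * l * dual_norm N (p - q) \<le> B"
      by (rule power2_le_imp_le) (use pos in simp)
    then show ?thesis
      using w l by (simp add: k_def field_simps)
  qed
  \<comment> \<open>By \<open>a2\<close>, \<open>\<psi> cstar - B\<^sup>2\<close> serves as the
    lower bound \<open>m\<close>; the range term at \<open>cstar\<close> is then exactly
    \<open>B\<^sup>2\<close>.\<close>
  have "R \<le> (\<alpha> * (\<psi> cstar - (\<psi> cstar - B\<^sup>2)) + 5 / 2 * k) * sqrt Q"
    unfolding R_def Q_def
  proof (rule ftrl_regret_bound[OF run norm beta' psi_sc Theta(3) \<open>\<alpha> \<ge> 0\<close> k \<alpha>k diam _ _ cstar])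
    show "\<psi> cstar - B\<^sup>2 \<le> \<psi> c" if "c \<in> \<Theta>" for c
      using a2[OF cstar that] by simp
  qed auto
  also have "\<alpha> * (\<psi> cstar - (\<psi> cstar - B\<^sup>2)) = 2 * w\<^sup>2 * k"
  proof -
    have "\<alpha> * (\<psi> cstar - (\<psi> cstar - B\<^sup>2)) = w * B / l"
      using pos by (simp add: \<alpha>_def power2_eq_square)
    also have "\<dots> = w ^ 4 * w\<^sup>2 * k"
      using l by (simp add: B power2_eq_square eval_nat_numeral)
    finally show ?thesis
      by (simp add: w4)
  qed
  \<comment> \<open>Since 25/16 is below \<open>w ^ 4 = 2\<close>, the constant 5/2 may be rounded
    up to \<open>2 * w\<^sup>2\<close>, matching the other summand.\<close>
  also have "(2 * w\<^sup>2 * k + 5 / 2 * k) * sqrt Q \<le> 4 * w\<^sup>2 * k * sqrt Q"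
  proof -
    have "(5 / 4)\<^sup>2 \<le> (w\<^sup>2)\<^sup>2"
      using w4 by (simp flip: power_mult) (simp add: power2_eq_square)
    then have "5 / 4 \<le> w\<^sup>2"
      by (rule power2_le_imp_le) simp
    then have "5 / 4 * k \<le> w\<^sup>2 * k"
      using k by (intro mult_right_mono) auto
    then show ?thesis
      by (intro mult_right_mono) (auto simp: Q_def sum_nonneg ac_simps)
  qed
  finally have regret: "R \<le> 4 * w\<^sup>2 * k * sqrt Q" .
  have N0: "N v \<ge> 0" for v
    by (rule is_normD(1)[OF norm])
  \<comment> \<open>The inner product splits into the suboptimality loss, nonnegative because
    \<open>xhat t\<close> is maximal for \<open>chat t\<close>, and the estimate loss, which the gap
    condition bounds below.\<close>
  have round: "\<Delta> * N (g t) \<le> g t \<bullet> (chat t - cstar)" "N (g t) \<le> K" if t: "t \<in> {1..T}" for t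
  proof -
    have xhat: "is_arg_max (\<lambda>x'. chat t \<bullet> x') (\<lambda>x'. x' \<in> X t) (xhat t)"
      and g: "g t = xhat t - x t"
      using run t by (auto simp: ftrl_run_def)
    then have xhat_in: "xhat t \<in> X t"
      by (simp add: is_arg_max_def)
    show "N (g t) \<le> K"
      unfolding g using b[OF t xhat_in x[OF t]] .
    have "N (g t) = N (x t - xhat t)"
      using is_normD(6)[OF norm, of "g t"] by (simp add: g)
    then have "\<Delta> * N (g t) \<le> cstar \<bullet> (x t - xhat t)"
      using c d[OF t] t xhat_in unfolding gap_condition_def by simp
    moreover have "chat t \<bullet> x t \<le> chat t \<bullet> xhat t"
      using xhat x[OF t] by (simp add: is_arg_max_linorder)
    ultimately show "\<Delta> * N (g t) \<le> g t \<bullet> (chat t - cstar)"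
      by (simp add: g algebra_simps inner_commute)
  qed
  have A: "\<Delta> * A \<le> R"
    unfolding A_def R_def sum_distrib_left by (intro sum_mono round)
  have A0: "A \<ge> 0"
    by (simp add: A_def sum_nonneg N0)
  have R0: "R \<ge> 0"
    using A A0 pos by (meson mult_nonneg_nonneg less_imp_le order_trans)
  have Q: "Q \<le> K * A"
    unfolding A_def Q_def sum_distrib_left power2_eq_square
    by (intro sum_mono mult_right_mono round N0)
  have "R \<le> 32 * k ^ 3 * K / \<Delta>\<^sup>2"
  proof (cases "R = 0")
    case True
    then show ?thesis
      using k pos by simp
  next
    case False
    \<comment> \<open>In a round with nonzero subgradient, the gap bound from below and duality with
      the diameter bound from above force \<open>\<Delta> \<le> k\<close>.\<close>
    then obtain t where t: "t \<in> {1..T}" "g t \<noteq> 0"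
      unfolding R_def by (metis (no_types, lifting) inner_zero_left sum.neutral)
    have chat: "chat t \<in> \<Theta>"
      using run t by (simp add: ftrl_run_def)
    have "\<Delta> * N (g t) \<le> N (g t) * dual_norm N (chat t - cstar)"
      using round(1)[OF t(1)] inner_le_norm_dual_norm[OF norm] by (rule order_trans)
    also have "\<dots> \<le> N (g t) * k"
      by (intro mult_left_mono diam chat cstar N0)
    finally have "N (g t) * \<Delta> \<le> N (g t) * k"
      by (simp add: mult.commute)
    moreover have "N (g t) > 0"
      using t(2) by (rule is_normD(3)[OF norm])
    ultimately have \<Delta>k: "\<Delta> \<le> k"
      by simp
    \<comment> \<open>Squaring makes the bound self-referential: \<open>Q\<close> is at most
      \<open>K * A\<close> and \<open>\<Delta> * A\<close> is at most \<open>R\<close>, so one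
      factor \<open>R\<close> cancels.\<close>
    have "R\<^sup>2 \<le> (4 * w\<^sup>2 * k * sqrt Q)\<^sup>2"
      using regret R0 by (rule power_mono)
    also have "\<dots> = 16 * w ^ 4 * k\<^sup>2 * Q"
      by (simp add: power_mult_distrib Q_def sum_nonneg flip: power_mult)
    also have "\<dots> \<le> 32 * k\<^sup>2 * (K * A)"
      using Q w4 by (simp add: mult_left_mono)
    finally have "\<Delta> * R\<^sup>2 \<le> \<Delta> * (32 * k\<^sup>2 * (K * A))"
      using pos by (intro mult_left_mono) auto
    also have "\<dots> = 32 * k\<^sup>2 * K * (\<Delta> * A)"
      by simp
    also have "\<dots> \<le> 32 * k\<^sup>2 * K * R"
      using A pos by (intro mult_left_mono) auto
    finally have "\<Delta> * R \<le> 32 * k\<^sup>2 * K"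
      using R0 False by (simp add: power2_eq_square)
    then have "\<Delta> * (\<Delta> * R) \<le> k * (32 * k\<^sup>2 * K)"
      by (rule mult_mono[OF \<Delta>k]) (use pos R0 k in auto)
    then show ?thesis
      using pos by (simp add: power2_eq_square power3_eq_cube field_simps)
  qed
  also have "\<dots> = 2 powr (5 / 4) * K * B ^ 3 / (lam powr (3 / 2) * \<Delta>\<^sup>2)"
  proof -
    \<comment> \<open>\<open>B ^ 3\<close> contributes \<open>w ^ 15\<close>; with the prefactor
      \<open>w ^ 5\<close> this gives \<open>w ^ 20\<close>, which is 32.\<close>
    have "w ^ 5 * B ^ 3 = w ^ 20 * k ^ 3 * l ^ 3"
      by (simp add: B power_mult_distrib flip: power_mult power_add)
    also have "w ^ 20 = (w ^ 4) ^ 5"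
      by (simp flip: power_mult)
    finally have "w ^ 5 * B ^ 3 = 32 * k ^ 3 * l ^ 3"
      by (simp add: w4)
    then have "w ^ 5 * K * B ^ 3 = 32 * k ^ 3 * K * l ^ 3"
      by (simp add: mult.assoc mult.left_commute)
    then show ?thesis
      unfolding powers l3 using l by (simp only:) simp
  qed
  finally show ?thesis
    by (simp add: R_def)
qed

end
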